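(* For every family $\mathcal{G}$ of graphs, the following three statements are equivalent: (i) the path-length is bounded on $\mathcal G$, i.e. there is a constant $c$ such that $\mathrm{pl}(G)\le c$ for every $G\in\mathcal G$; (ii) there are constants $L\ge 1$, $C\ge 0$ such that every $G\in\mathcal G$ admits an $(L,C)$-quasi-isometry to a path; (iii) there is a constant $C'\ge 0$ such that every $G\in\mathcal G$ admits a $(1,C')$-quasi-isometry to a path.
   Context: All graphs are nonempty, connected, finite, unweighted, undirected, loopless, without multiple edges. $d_G(u,v)$ is the number of edges of a shortest path of $G$ between $u$ and $v$. A path-decomposition of $G=(V,E)$ is a sequence $X_1,\dots,X_q$ of subsets of $V$ (bags) such that $\bigcup_i X_i=V$; every edge has both ends in some bag; and $X_i\cap X_k\subseteq X_j$ whenever $i\le j\le k$. Its length is $\max_i\max_{u,v\in X_i} d_G(u,v)$. The path-length $\mathrm{pl}(G)$ is the minimum length over all path-decompositions of $G$. Quasi-isometry to a path: let $P$ be a finite path graph, possibly with positive real weights on its edges, and let $d_P(x,y)$ be the sum of the weights of the edges of the subpath of $P$ between $x$ and $y$ (all weights equal 1 if $P$ is unweighted). For $L\ge1$, $C\ge 0$, a map $\psi:V(G)\to V(P)$ is an $(L,C)$-quasi-isometry if (1) for all $u,v\in V(G)$, $\frac1L d_G(u,v)-C\le d_P(\psi(u),\psi(v))\le L\,d_G(u,v)+C$; and (2) for every $y\in V(P)$ there is $v\in V(G)$ with $d_P(\psi(v),y)\le C$. *)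

theory Defs
  imports Complex_Main "Graph_Theory.Graph_Theory"
begin

text \<open>
  A simple undirected graph is a symmetric, loop-free finite digraph whose arcs are ordered pairs of
  vertices: the edge \<open>uv\<close> is represented by the two arcs \<open>(u, v)\<close> and \<open>(v, u)\<close>.
  Nonemptiness is part of the predicate \<^const>\<open>connected\<close>.
\<close>

definition connected_graph :: "'a pair_pre_digraph \<Rightarrow> bool" where
  "connected_graph G \<longleftrightarrow> pair_graph G \<and> connected (with_proj G)"

definition graph_dist :: "'a pair_pre_digraph \<Rightarrow> 'a \<Rightarrow> 'a \<Rightarrow> nat" where
  "graph_dist G u v = (LEAST k. \<exists>p. pre_digraph.apath (with_proj G) u p v \<and> length p = k)"

definition path_decomposition :: "'a pair_pre_digraph \<Rightarrow> 'a set list \<Rightarrow> bool" where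
  "path_decomposition G Xs \<longleftrightarrow>
     \<Union> (set Xs) = pverts G \<and>
     (\<forall>(u, v) \<in> parcs G. \<exists>X \<in> set Xs. u \<in> X \<and> v \<in> X) \<and>
     (\<forall>i j k. i \<le> j \<and> j \<le> k \<and> k < length Xs \<longrightarrow> Xs ! i \<inter> Xs ! k \<subseteq> Xs ! j)"

text \<open>
  The maximum ranges over all bags at once, so empty bags contribute nothing; the set is
  nonempty because the bags cover the nonempty vertex set.
\<close>

definition decomposition_length :: "'a pair_pre_digraph \<Rightarrow> 'a set list \<Rightarrow> nat" where
  "decomposition_length G Xs = Max {graph_dist G u v | u v X. X \<in> set Xs \<and> u \<in> X \<and> v \<in> X}"

definition path_length :: "'a pair_pre_digraph \<Rightarrow> nat" where
  "path_length G = (LEAST l. \<exists>Xs. path_decomposition G Xs \<and> decomposition_length G Xs = l)"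

text \<open>
  A finite weighted path is given, up to isomorphism, by the list \<open>ws\<close> of its edge weights: its
  vertices are \<open>0, \<dots>, length ws\<close>, and \<open>ws ! i\<close> is the weight of the edge between \<open>i\<close> and
  \<open>i + 1\<close>. The unweighted path with \<open>n\<close> edges is \<open>replicate n 1\<close>.
\<close>

definition weighted_path :: "real list \<Rightarrow> bool" where
  "weighted_path ws \<longleftrightarrow> (\<forall>w \<in> set ws. w > 0)"

definition path_verts :: "real list \<Rightarrow> nat set" where
  "path_verts ws = {0..length ws}"

definition path_dist :: "real list \<Rightarrow> nat \<Rightarrow> nat \<Rightarrow> real" where
  "path_dist ws x y = (\<Sum>i = min x y..<max x y. ws ! i)"

definition quasi_isometry ::
    "real \<Rightarrow> real \<Rightarrow> 'a pair_pre_digraph \<Rightarrow> real list \<Rightarrow> ('a \<Rightarrow> nat) \<Rightarrow> bool" where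
  "quasi_isometry L C G ws \<psi> \<longleftrightarrow>
     \<psi> \<in> pverts G \<rightarrow> path_verts ws \<and>
     (\<forall>u \<in> pverts G. \<forall>v \<in> pverts G.
        1 / L * real (graph_dist G u v) - C \<le> path_dist ws (\<psi> u) (\<psi> v) \<and>
        path_dist ws (\<psi> u) (\<psi> v) \<le> L * real (graph_dist G u v) + C) \<and>
     (\<forall>y \<in> path_verts ws. \<exists>v \<in> pverts G. path_dist ws (\<psi> v) y \<le> C)"

definition quasi_isometric_to_path :: "real \<Rightarrow> real \<Rightarrow> 'a pair_pre_digraph \<Rightarrow> bool" where
  "quasi_isometric_to_path L C G \<longleftrightarrow>
     (\<exists>ws \<psi>. weighted_path ws \<and> quasi_isometry L C G ws \<psi>)"

text \<open>Agreement with the shortest-path distance of the library under unit arc weights.\<close>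

lemma graph_dist_eq_mu:
  assumes "connected_graph G" "u \<in> pverts G" "v \<in> pverts G"
  shows "ereal (real (graph_dist G u v)) = wf_digraph.\<mu> (with_proj G) (\<lambda>_. 1) u v"
proof -
  interpret pair_graph G using assms(1) by (simp add: connected_graph_def)
  have cost: "awalk_cost (\<lambda>_. 1) p = real (length p)" for p :: "('a \<times> 'a) list"
    by (induct p) auto
  have "u \<rightarrow>\<^sup>*\<^bsub>mk_symmetric (with_proj G)\<^esub> v"
    using assms unfolding connected_graph_def connected_def strongly_connected_def by auto
  then have "u \<rightarrow>\<^sup>*\<^bsub>with_proj G\<^esub> v"
    using reachable_mk_symmetric_eq[OF sym_arcs, of u v] by blast
  then obtain p where p: "apath u p v" "\<mu> (\<lambda>_. 1) u v = awalk_cost (\<lambda>_. 1) p"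
    using min_cost_awalk[of u v "\<lambda>_. 1"] by auto
  have "length p \<le> k" if q: "\<exists>q. apath u q v \<and> length q = k" for k
  proof -
    from q obtain q where q': "apath u q v" "length q = k" by blast
    then have "\<mu> (\<lambda>_. 1) u v \<le> awalk_cost (\<lambda>_. 1) q"
      by (intro min_cost_le_walk_cost awalkI_apath)
    then show ?thesis using p(2) cost q'(2) by simp
  qed
  then have "graph_dist G u v = length p"
    unfolding graph_dist_def using p(1) by (intro Least_equality) auto
  then show ?thesis using p(2) cost by simp
qed

text \<open>The minimum defining the path-length is attained.\<close>

lemma path_length_attained:
  assumes "connected_graph G"
  shows "\<exists>Xs. path_decomposition G Xs \<and> decomposition_length G Xs = path_length G"
proof -
  interpret pair_graph G using assms by (simp add: connected_graph_def)
  have "path_decomposition G [pverts G]"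
    unfolding path_decomposition_def by (auto intro: in_arcsD1 in_arcsD2)
  then have "\<exists>l Xs. path_decomposition G Xs \<and> decomposition_length G Xs = l" by blast
  then show ?thesis unfolding path_length_def by (rule LeastI_ex)
qed

end

theory Submission
  imports Defs
begin

text \<open>
  A quasi-isometry to a path places every vertex at a real coordinate so that adjacent vertices are
  at most \<open>L + C\<close> apart. Hence the preimages of the windows of width \<open>L + C\<close> that start at the
  vertices of the path form a path-decomposition, of length at most \<open>L * (L + 2 * C)\<close>.

  Conversely, given a path-decomposition of length \<open>l\<close>, map each vertex to its distance from a fixed
  vertex \<open>s\<close> of the first nonempty bag. If the bag of \<open>u\<close> does not come after the bag of \<open>v\<close>,
  then some geodesic from \<open>s\<close> to \<open>v\<close> meets the bag of \<open>u\<close>, so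
  \<open>dist u v \<le> dist s v - dist s u + 2 * l\<close>.
\<close>

section \<open>Distances in connected graphs\<close>

text \<open>\<open>graph_dist\<close> minimises over simple paths only. The link to \<mu>, an
  infimum over all walks, extends the bound to arbitrary walks, so walks can be concatenated,
  reversed and shortened freely below.\<close>

lemma graph_dist_le_length:
  assumes "connected_graph G" "pre_digraph.awalk (with_proj G) u p v"
  shows "graph_dist G u v \<le> length p"
proof -
  interpret pair_graph G using assms(1) by (simp add: connected_graph_def)
  have cost: "awalk_cost (\<lambda>_. 1) q = real (length q)" for q :: "('a \<times> 'a) list"
    by (induct q) auto
  have "u \<in> pverts G" "v \<in> pverts G"
    using assms(2) awalk_hd_in_verts awalk_last_in_verts by auto
  moreover have "\<mu> (\<lambda>_. 1) u v \<le> awalk_cost (\<lambda>_. 1) p"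
    using assms(2) by (rule min_cost_le_walk_cost)
  ultimately have "ereal (real (graph_dist G u v)) \<le> ereal (real (length p))"
    using graph_dist_eq_mu[OF assms(1), of u v] cost[of p] by simp
  then show ?thesis by simp
qed

lemma graph_dist_attained:
  assumes "connected_graph G" "u \<in> pverts G" "v \<in> pverts G"
  obtains p where "pre_digraph.awalk (with_proj G) u p v" "length p = graph_dist G u v"
proof -
  interpret pair_graph G using assms(1) by (simp add: connected_graph_def)
  have "u \<rightarrow>\<^sup>*\<^bsub>mk_symmetric (with_proj G)\<^esub> v"
    using assms unfolding connected_graph_def connected_def strongly_connected_def by auto
  then have "u \<rightarrow>\<^sup>*\<^bsub>with_proj G\<^esub> v"
    using reachable_mk_symmetric_eq[OF sym_arcs, of u v] by blast
  then have "\<exists>k p. apath u p v \<and> length p = k"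
    using reachable_apath by auto
  then have "\<exists>p. apath u p v \<and> length p = graph_dist G u v"
    unfolding graph_dist_def by (rule LeastI_ex)
  then show ?thesis using that awalkI_apath by blast
qed

lemma graph_dist_self:
  assumes "connected_graph G" "u \<in> pverts G"
  shows "graph_dist G u u = 0"
proof -
  interpret pair_graph G using assms(1) by (simp add: connected_graph_def)
  show ?thesis using graph_dist_le_length[OF assms(1), of u "[]" u] assms(2)
    by (simp add: awalk_Nil_iff)
qed

lemma graph_dist_eq_0D:
  assumes "connected_graph G" "u \<in> pverts G" "v \<in> pverts G" "graph_dist G u v = 0"
  shows "u = v"
proof -
  interpret pair_graph G using assms(1) by (simp add: connected_graph_def)
  show ?thesis using graph_dist_attained[OF assms(1-3)] assms(4)
    by (metis awalk_Nil_iff length_0_conv)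
qed

lemma graph_dist_triangle:
  assumes "connected_graph G" "u \<in> pverts G" "v \<in> pverts G" "w \<in> pverts G"
  shows "graph_dist G u w \<le> graph_dist G u v + graph_dist G v w"
proof -
  interpret pair_graph G using assms(1) by (simp add: connected_graph_def)
  obtain p q where "awalk u p v" "length p = graph_dist G u v"
    "awalk v q w" "length q = graph_dist G v w"
    using graph_dist_attained assms by metis
  then show ?thesis
    using graph_dist_le_length[OF assms(1), of u "p @ q" w] awalk_appendI by fastforce
qed

lemma graph_dist_commute:
  assumes "connected_graph G" "u \<in> pverts G" "v \<in> pverts G"
  shows "graph_dist G u v = graph_dist G v u"
proof -
  interpret pair_graph G using assms(1) by (simp add: connected_graph_def)
  have length_rev: "length (rev_path p) = length p" for p :: "('a \<times> 'a) list"
    by (induct p) auto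
  have "graph_dist G y x \<le> graph_dist G x y" if xy: "x \<in> pverts G" "y \<in> pverts G" for x y
  proof -
    obtain p where "awalk x p y" "length p = graph_dist G x y"
      using graph_dist_attained[OF assms(1) xy] .
    then show ?thesis
      using graph_dist_le_length[OF assms(1), of y "rev_path p" x] length_rev by simp
  qed
  then show ?thesis using assms(2,3) by (simp add: antisym)
qed

lemma graph_dist_arc:
  assumes "connected_graph G" "(u, v) \<in> parcs G"
  shows "graph_dist G u v \<le> 1"
proof -
  interpret pair_graph G using assms(1) by (simp add: connected_graph_def)
  show ?thesis
    using graph_dist_le_length[OF assms(1), of u "[(u, v)]" v] arc_implies_awalk[OF assms(2)] by simp
qed

text \<open>The predecessor of \<open>v\<close> on a shortest walk works: the rest of the walk
  bounds its distance by \<open>k\<close>, and the triangle inequality across the last arc forbids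
  anything smaller.\<close>

lemma graph_dist_SucE:
  assumes "connected_graph G" "u \<in> pverts G" "v \<in> pverts G" "graph_dist G u v = Suc k"
  obtains v' where "v' \<in> pverts G" "(v', v) \<in> parcs G" "graph_dist G u v' = k"
proof -
  interpret pair_graph G using assms(1) by (simp add: connected_graph_def)
  obtain p where p: "awalk u p v" "length p = Suc k"
    using graph_dist_attained[OF assms(1-3)] assms(4) by metis
  obtain q x y where q: "p = q @ [(x, y)]"
    using p(2) by (metis length_Suc_conv_rev surj_pair)
  then have w: "awalk u q x" "(x, v) \<in> parcs G"
    using p(1) by (auto simp: awalk_simps)
  then have x: "x \<in> pverts G" by (auto intro: in_arcsD1)
  have "graph_dist G u x \<le> k"
    using graph_dist_le_length[OF assms(1) w(1)] p(2) q by simp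
  moreover have "Suc k \<le> graph_dist G u x + 1"
    using graph_dist_triangle[OF assms(1,2) x assms(3)] graph_dist_arc[OF assms(1) w(2)] assms(4)
    by simp
  ultimately show ?thesis using that[of x] x w(2) by simp
qed

lemma graph_dist_intermediate:
  assumes "connected_graph G" "u \<in> pverts G" "v \<in> pverts G" "k \<le> graph_dist G u v"
  obtains w where "w \<in> pverts G" "graph_dist G u w = k"
proof -
  have "\<exists>w \<in> pverts G. graph_dist G u w = k"
    using assms(4)
  \<comment> \<open>The induction descends from \<open>graph_dist G u v\<close>, moving to a
    predecessor one step closer to \<open>u\<close> each time.\<close>
  proof (induction k rule: inc_induct)
    case base
    then show ?case using assms(3) by blast
  next
    case (step n)
    then show ?case using graph_dist_SucE[OF assms(1,2)] by metis
  qed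
  then show ?thesis using that by blast
qed

section \<open>Distances on weighted paths\<close>

lemma path_dist_mono:
  assumes "weighted_path ws" "i \<le> j" "j \<le> length ws"
  shows "path_dist ws 0 i \<le> path_dist ws 0 j"
  using assms unfolding path_dist_def weighted_path_def
  by (auto intro!: sum_mono2 simp: less_imp_le)

text \<open>The prefix sum \<open>path_dist ws 0\<close> is a monotone coordinate that embeds the
  path isometrically in the real line, so later arguments only compare real numbers.\<close>

lemma path_dist_eq_abs:
  assumes "weighted_path ws" "x \<le> length ws" "y \<le> length ws"
  shows "path_dist ws x y = \<bar>path_dist ws 0 x - path_dist ws 0 y\<bar>"
proof -
  have *: "path_dist ws i j = path_dist ws 0 j - path_dist ws 0 i" if "i \<le> j" for i j
    using that sum.atLeastLessThan_concat[of 0 i j "(!) ws"] by (simp add: path_dist_def)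
  have comm: "path_dist ws x y = path_dist ws y x"
    by (simp add: path_dist_def min.commute max.commute)
  show ?thesis
  proof (cases "x \<le> y")
    case True
    show ?thesis using *[OF True] path_dist_mono[OF assms(1) True assms(3)] by linarith
  next
    case False
    then have "y \<le> x" by simp
    show ?thesis
      using *[OF \<open>y \<le> x\<close>] comm path_dist_mono[OF assms(1) \<open>y \<le> x\<close> assms(2)] by linarith
  qed
qed

lemma path_dist_unit:
  assumes "x \<le> n" "y \<le> n"
  shows "path_dist (replicate n 1) x y = \<bar>real x - real y\<bar>"
proof -
  have "path_dist (replicate n 1) x y = (\<Sum>i = min x y..<max x y. 1)"
    unfolding path_dist_def using assms by (intro sum.cong) auto
  then show ?thesis by (simp add: min_def max_def of_nat_diff)
qed

section \<open>Length of path-decompositions\<close>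

lemma finite_bag_distances:
  assumes "connected_graph G" "path_decomposition G Xs"
  shows "finite {graph_dist G u v | u v X. X \<in> set Xs \<and> u \<in> X \<and> v \<in> X}"
proof (rule finite_subset)
  interpret pair_graph G using assms(1) by (simp add: connected_graph_def)
  show "finite ((\<lambda>(u, v). graph_dist G u v) ` (pverts G \<times> pverts G))"
    using pair_finite_verts by simp
  show "{graph_dist G u v | u v X. X \<in> set Xs \<and> u \<in> X \<and> v \<in> X}
      \<subseteq> (\<lambda>(u, v). graph_dist G u v) ` (pverts G \<times> pverts G)"
    using assms(2) unfolding path_decomposition_def by fast
qed

lemma graph_dist_le_decomposition_length:
  assumes "connected_graph G" "path_decomposition G Xs" "X \<in> set Xs" "u \<in> X" "v \<in> X"
  shows "graph_dist G u v \<le> decomposition_length G Xs"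
  unfolding decomposition_length_def
  by (rule Max_ge[OF finite_bag_distances[OF assms(1,2)]]) (use assms(3-5) in blast)

text \<open>The \<open>Max\<close> is itself one of the bag distances, since their set is finite and
  nonempty. The bound is real so that it can be an expression in \<open>L\<close> and
  \<open>C\<close>.\<close>

lemma path_length_le:
  assumes "connected_graph G" "path_decomposition G Xs"
    and bound: "\<And>X u v. X \<in> set Xs \<Longrightarrow> u \<in> X \<Longrightarrow> v \<in> X \<Longrightarrow> real (graph_dist G u v) \<le> b"
  shows "real (path_length G) \<le> b"
proof -
  let ?D = "{graph_dist G u v | u v X. X \<in> set Xs \<and> u \<in> X \<and> v \<in> X}"
  have "pverts G \<noteq> {}"
    using assms(1) by (auto simp: connected_graph_def connected_def strongly_connected_def)
  then have "?D \<noteq> {}"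
    using assms(2) unfolding path_decomposition_def by fast
  then have "decomposition_length G Xs \<in> ?D"
    unfolding decomposition_length_def using finite_bag_distances[OF assms(1,2)] by (rule Max_in[rotated])
  then have "real (decomposition_length G Xs) \<le> b"
    using bound by auto
  moreover have "path_length G \<le> decomposition_length G Xs"
    unfolding path_length_def using assms(2) by (auto intro: Least_le)
  ultimately show ?thesis by linarith
qed

section \<open>From quasi-isometries to path-decompositions\<close>

lemma path_length_le_of_quasi_isometry:
  assumes G: "connected_graph G" and L: "L \<ge> 1" and C: "C \<ge> 0"
    and qi: "quasi_isometric_to_path L C G"
  shows "real (path_length G) \<le> L * (L + 2 * C)"
proof -
  interpret pair_graph G using G by (simp add: connected_graph_def)
  obtain ws \<psi> where ws: "weighted_path ws" and \<psi>: "quasi_isometry L C G ws \<psi>"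
    using qi unfolding quasi_isometric_to_path_def by blast
  have range: "\<psi> v \<le> length ws" if "v \<in> pverts G" for v
    using \<psi> that unfolding quasi_isometry_def path_verts_def by auto
  define p where "p = path_dist ws 0"
  define Xs where
    "Xs = map (\<lambda>j. {v \<in> pverts G. p j \<le> p (\<psi> v) \<and> p (\<psi> v) \<le> p j + (L + C)}) [0..<Suc (length ws)]"
  have lower: "1 / L * real (graph_dist G u v) - C \<le> \<bar>p (\<psi> u) - p (\<psi> v)\<bar>"
    and upper: "\<bar>p (\<psi> u) - p (\<psi> v)\<bar> \<le> L * real (graph_dist G u v) + C"
    if "u \<in> pverts G" "v \<in> pverts G" for u v
    using \<psi> that path_dist_eq_abs[OF ws range[OF that(1)] range[OF that(2)]]
    unfolding quasi_isometry_def p_def by metis+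
  have nth: "Xs ! j = {v \<in> pverts G. p j \<le> p (\<psi> v) \<and> p (\<psi> v) \<le> p j + (L + C)}"
    if "j < length Xs" for j
    using that unfolding Xs_def by (simp del: upt_Suc)
  have bag: "Xs ! \<psi> v \<in> set Xs" "v \<in> Xs ! \<psi> v" if "v \<in> pverts G" for v
  proof -
    have "\<psi> v < length Xs" using range[OF that] by (simp add: Xs_def)
    then show "Xs ! \<psi> v \<in> set Xs" by (rule nth_mem)
    show "v \<in> Xs ! \<psi> v" using nth[OF \<open>\<psi> v < length Xs\<close>] that L C by simp
  qed
  have "path_decomposition G Xs"
    unfolding path_decomposition_def
  proof (intro conjI allI impI)
    show "\<Union> (set Xs) = pverts G"
    proof
      show "\<Union> (set Xs) \<subseteq> pverts G" unfolding Xs_def by auto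
      show "pverts G \<subseteq> \<Union> (set Xs)" using bag by blast
    qed
    have "\<exists>X \<in> set Xs. u \<in> X \<and> v \<in> X"
      if uv: "(u, v) \<in> parcs G" and le: "p (\<psi> u) \<le> p (\<psi> v)" for u v
    proof -
      have V: "u \<in> pverts G" "v \<in> pverts G" using uv by (auto intro: wellformed')
      \<comment> \<open>This fixes the window width: an arc is stretched to at most
        \<open>L + C\<close>, so the window starting at the end with the smaller coordinate catches
        both ends.\<close>
      have "L * real (graph_dist G u v) \<le> L * 1"
        using graph_dist_arc[OF G uv] L by (intro mult_left_mono) auto
      then have "p (\<psi> v) \<le> p (\<psi> u) + (L + C)"
        using upper[OF V] le by linarith
      then have "v \<in> Xs ! \<psi> u"
        using nth[of "\<psi> u"] range[OF V(1)] V le by (simp add: Xs_def del: upt_Suc)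
      then show ?thesis using bag[OF V(1)] by blast
    qed
    then show "\<forall>(u, v) \<in> parcs G. \<exists>X \<in> set Xs. u \<in> X \<and> v \<in> X"
      using arcs_symmetric by (smt (verit) case_prodI2)
    \<comment> \<open>For \<open>v\<close> in bags \<open>i\<close> and \<open>k\<close>: \<open>p j
      \<le> p k \<le> p (\<psi> v) \<le> p i + (L + C) \<le> p j + (L + C)\<close>.\<close>
    fix i j k assume ijk: "i \<le> j \<and> j \<le> k \<and> k < length Xs"
    then have "p i \<le> p j" "p j \<le> p k"
      using path_dist_mono[OF ws] by (auto simp: p_def Xs_def)
    then show "Xs ! i \<inter> Xs ! k \<subseteq> Xs ! j"
      using nth ijk by auto
  qed
  moreover have "real (graph_dist G u v) \<le> L * (L + 2 * C)"
    if X: "X \<in> set Xs" "u \<in> X" "v \<in> X" for X u v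
  proof -
    have V: "u \<in> pverts G" "v \<in> pverts G" and "\<bar>p (\<psi> u) - p (\<psi> v)\<bar> \<le> L + C"
      using X unfolding Xs_def by auto
    then have "real (graph_dist G u v) / L \<le> L + 2 * C"
      using lower[OF V] by simp
    then show ?thesis using L by (simp add: pos_divide_le_eq mult.commute)
  qed
  ultimately show ?thesis by (rule path_length_le[OF G])
qed

section \<open>From path-decompositions to quasi-isometries\<close>

text \<open>Induction along a geodesic: its last edge lies in some bag \<open>c\<close>. If \<open>c < i\<close> then \<open>v\<close> itself
  lies in bag \<open>i\<close>, and otherwise the induction hypothesis applies to the predecessor of \<open>v\<close>.\<close>

lemma geodesic_meets_bag:
  assumes G: "connected_graph G" and Xs: "path_decomposition G Xs"
    and s: "s \<in> pverts G" "s \<in> Xs ! a" and "a \<le> i"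
    and "v \<in> Xs ! b" "i \<le> b" "b < length Xs"
  shows "\<exists>w \<in> Xs ! i. graph_dist G s v = graph_dist G s w + graph_dist G w v"
  using assms(6-8)
\<comment> \<open>The bag index \<open>b\<close> must vary as well, because the predecessor of
  \<open>v\<close> need not lie in bag \<open>b\<close>.\<close>
proof (induction "graph_dist G s v" arbitrary: v b)
  have interval: "x \<in> Xs ! j"
    if "x \<in> Xs ! i'" "x \<in> Xs ! k" "i' \<le> j" "j \<le> k" "k < length Xs" for x i' j k
    using Xs that unfolding path_decomposition_def by blast
  have verts: "x \<in> pverts G" if "x \<in> Xs ! j" "j < length Xs" for x j
    using Xs that unfolding path_decomposition_def by (metis UnionI nth_mem)
  {
    case 0
    \<comment> \<open>Now \<open>s\<close> lies in bags \<open>a\<close> and \<open>b\<close>, hence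
      in bag \<open>i\<close> between them, and serves as \<open>w\<close>.\<close>
    then have "s = v" using graph_dist_eq_0D[OF G s(1)] verts by metis
    then have "s \<in> Xs ! i" using interval[OF s(2)] 0 \<open>a \<le> i\<close> by blast
    then show ?case using graph_dist_self[OF G s(1)] \<open>s = v\<close> by force
  next
    case (Suc k)
    have v: "v \<in> pverts G" using Suc verts by blast
    obtain v' where v': "v' \<in> pverts G" "(v', v) \<in> parcs G" "graph_dist G s v' = k"
      using graph_dist_SucE[OF G s(1) v] Suc(2) by metis
    obtain c where c: "c < length Xs" "v' \<in> Xs ! c" "v \<in> Xs ! c"
      using Xs v'(2) unfolding path_decomposition_def by (fastforce simp: in_set_conv_nth)
    show ?case
    proof (cases "i \<le> c")
      case True
      obtain w where w: "w \<in> Xs ! i" "graph_dist G s v' = graph_dist G s w + graph_dist G w v'"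
        using Suc(1)[OF v'(3)[symmetric] c(2) True c(1)] by blast
      have wV: "w \<in> pverts G" using verts w(1) True c(1) by simp
      \<comment> \<open>Going through \<open>w\<close> and \<open>v'\<close> to \<open>v\<close>
        takes at most \<open>k + 1\<close> steps, which is the distance from \<open>s\<close> to
        \<open>v\<close>; so \<open>w\<close> lies on a geodesic to \<open>v\<close> too.\<close>
      have "graph_dist G w v \<le> graph_dist G w v' + 1"
        using graph_dist_triangle[OF G wV v'(1) v] graph_dist_arc[OF G v'(2)] by linarith
      then have "graph_dist G s v = graph_dist G s w + graph_dist G w v"
        using graph_dist_triangle[OF G s(1) wV v] w(2) v'(3) Suc(2) by linarith
      then show ?thesis using w(1) by blast
    next
      case False
      then have "v \<in> Xs ! i" using interval[OF c(3)] Suc by simp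
      then show ?thesis using graph_dist_self[OF G v] by force
    qed
  }
qed

lemma quasi_isometric_of_path_length:
  assumes G: "connected_graph G" and l: "path_length G \<le> l"
  shows "quasi_isometric_to_path 1 (2 * real l) G"
proof -
  interpret pair_graph G using G by (simp add: connected_graph_def)
  obtain Xs where Xs: "path_decomposition G Xs" "decomposition_length G Xs = path_length G"
    using path_length_attained[OF G] by blast
  have bag_dist: "graph_dist G u v \<le> l" if "j < length Xs" "u \<in> Xs ! j" "v \<in> Xs ! j" for u v j
    using graph_dist_le_decomposition_length[OF G Xs(1) _ that(2,3)] that(1) Xs(2) l by force
  have verts: "x \<in> pverts G" if "x \<in> Xs ! j" "j < length Xs" for x j
    using Xs(1) that unfolding path_decomposition_def by (metis UnionI nth_mem)
  have in_bag: "\<exists>j < length Xs. v \<in> Xs ! j" if "v \<in> pverts G" for v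
    using Xs(1) that unfolding path_decomposition_def by (metis UnionE in_set_conv_nth)
  have "pverts G \<noteq> {}"
    using G by (auto simp: connected_graph_def connected_def strongly_connected_def)
  then have ex: "\<exists>j. j < length Xs \<and> Xs ! j \<noteq> {}" using in_bag by blast
  \<comment> \<open>The list may start with empty bags; the first nonempty one precedes or equals
    every bag that contains a vertex.\<close>
  define a where "a = (LEAST j. j < length Xs \<and> Xs ! j \<noteq> {})"
  have a: "a < length Xs" "Xs ! a \<noteq> {}" using LeastI_ex[OF ex] by (simp_all add: a_def)
  have a_least: "a \<le> j" if "j < length Xs" "v \<in> Xs ! j" for j v
    unfolding a_def by (rule Least_le) (use that in blast)
  obtain s where s: "s \<in> Xs ! a" using a(2) by blast
  have sV: "s \<in> pverts G" using verts[OF s a(1)] .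
  \<comment> \<open>The geodesic vertex \<open>w\<close> shares a bag with \<open>u\<close>.
    Replacing \<open>w\<close> by \<open>u\<close> costs at most \<open>l\<close> in the distance to
    \<open>v\<close> and at most \<open>l\<close> in the distance to \<open>s\<close>.\<close>
  have key: "graph_dist G u v + graph_dist G s u \<le> graph_dist G s v + 2 * l"
    if h: "i \<le> j" "j < length Xs" "u \<in> Xs ! i" "v \<in> Xs ! j" for u v i j
  proof -
    have i: "i < length Xs" using h by simp
    have "a \<le> i" using a_least[OF i h(3)] .
    then obtain w where w: "w \<in> Xs ! i" "graph_dist G s v = graph_dist G s w + graph_dist G w v"
      using geodesic_meets_bag[OF G Xs(1) sV s _ h(4,1,2)] by blast
    have V: "u \<in> pverts G" "v \<in> pverts G" "w \<in> pverts G" using verts h i w(1) by auto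
    have "graph_dist G u v \<le> l + graph_dist G w v"
      using graph_dist_triangle[OF G V(1,3,2)] bag_dist[OF i h(3) w(1)] by linarith
    moreover have "graph_dist G s u \<le> graph_dist G s w + l"
      using graph_dist_triangle[OF G sV V(3,1)] bag_dist[OF i w(1) h(3)] by linarith
    ultimately show ?thesis using w(2) by linarith
  qed
  \<comment> \<open>The target path has as many edges as the eccentricity of \<open>s\<close>, so
    its vertices are exactly the attained distances from \<open>s\<close>.\<close>
  define n where "n = Max (graph_dist G s ` pverts G)"
  have fin: "finite (graph_dist G s ` pverts G)" using pair_finite_verts by simp
  have le_n: "graph_dist G s v \<le> n" if "v \<in> pverts G" for v
    unfolding n_def using fin that by simp
  have "n \<in> graph_dist G s ` pverts G"
    unfolding n_def using fin sV by (intro Max_in) auto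
  then obtain z where z: "z \<in> pverts G" "graph_dist G s z = n" by blast
  have "quasi_isometry 1 (2 * real l) G (replicate n 1) (graph_dist G s)"
    unfolding quasi_isometry_def
  proof (intro conjI ballI)
    show "graph_dist G s \<in> pverts G \<rightarrow> path_verts (replicate n 1)"
      using le_n by (simp add: path_verts_def)
  next
    fix u v assume uv: "u \<in> pverts G" "v \<in> pverts G"
    have dist: "path_dist (replicate n 1) (graph_dist G s u) (graph_dist G s v) =
        \<bar>real (graph_dist G s u) - real (graph_dist G s v)\<bar>"
      using path_dist_unit le_n uv by simp
    have comm: "graph_dist G u v = graph_dist G v u" using graph_dist_commute[OF G uv] .
    obtain i j where "i < length Xs" "u \<in> Xs ! i" "j < length Xs" "v \<in> Xs ! j"
      using in_bag uv by blast
    \<comment> \<open>Either bag may come first; the absolute value in \<open>dist\<close> absorbs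
      both cases.\<close>
    then have "graph_dist G u v + graph_dist G s u \<le> graph_dist G s v + 2 * l \<or>
        graph_dist G u v + graph_dist G s v \<le> graph_dist G s u + 2 * l"
      using key comm by (metis nat_le_linear)
    then show "1 / 1 * real (graph_dist G u v) - 2 * real l
        \<le> path_dist (replicate n 1) (graph_dist G s u) (graph_dist G s v)"
      using dist by linarith
    have "graph_dist G s u \<le> graph_dist G s v + graph_dist G u v"
      "graph_dist G s v \<le> graph_dist G s u + graph_dist G u v"
      using graph_dist_triangle[OF G sV] uv comm by metis+
    then show "path_dist (replicate n 1) (graph_dist G s u) (graph_dist G s v)
        \<le> 1 * real (graph_dist G u v) + 2 * real l"
      using dist by linarith
  next
    fix y assume "y \<in> path_verts (replicate n 1)"
    then have y: "y \<le> n" by (simp add: path_verts_def)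
    then obtain v where v: "v \<in> pverts G" "graph_dist G s v = y"
      using graph_dist_intermediate[OF G sV z(1), of y] z(2) by auto
    then show "\<exists>v \<in> pverts G. path_dist (replicate n 1) (graph_dist G s v) y \<le> 2 * real l"
      using path_dist_unit[OF y y] by (intro bexI[of _ v]) auto
  qed
  moreover have "weighted_path (replicate n 1)" by (simp add: weighted_path_def)
  ultimately show ?thesis unfolding quasi_isometric_to_path_def by blast
qed

theorem theorem2:
  fixes \<G> :: "'a pair_pre_digraph set"
  assumes "\<forall>G \<in> \<G>. connected_graph G"
  shows "((\<exists>c::real. \<forall>G \<in> \<G>. real (path_length G) \<le> c) \<longleftrightarrow>
          (\<exists>L C. L \<ge> 1 \<and> C \<ge> 0 \<and> (\<forall>G \<in> \<G>. quasi_isometric_to_path L C G))) \<and>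
         ((\<exists>L C. L \<ge> 1 \<and> C \<ge> 0 \<and> (\<forall>G \<in> \<G>. quasi_isometric_to_path L C G)) \<longleftrightarrow>
          (\<exists>C'. C' \<ge> 0 \<and> (\<forall>G \<in> \<G>. quasi_isometric_to_path 1 C' G)))"
    (is "(?bounded \<longleftrightarrow> ?qi) \<and> (?qi \<longleftrightarrow> ?qi1)")
proof -
  have "?qi1" if bounded: ?bounded
  proof -
    obtain c :: real where c: "\<And>G. G \<in> \<G> \<Longrightarrow> real (path_length G) \<le> c"
      using bounded by blast
    \<comment> \<open>Path-lengths are natural numbers, so the real bound may be rounded down. If
      \<open>c\<close> is negative the family is empty, and \<open>nat\<close> still keeps the
      constant nonnegative.\<close>
    have "quasi_isometric_to_path 1 (2 * real (nat \<lfloor>c\<rfloor>)) G" if "G \<in> \<G>" for G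
      using quasi_isometric_of_path_length assms le_nat_floor[OF c[OF that]] that by blast
    then show ?thesis by (intro exI[of _ "2 * real (nat \<lfloor>c\<rfloor>)"]) simp
  qed
  moreover have "?qi" if ?qi1
    using that by (meson order_refl)
  moreover have "?bounded" if ?qi
    using that path_length_le_of_quasi_isometry assms by meson
  ultimately show ?thesis by blast
qed

end
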